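(* Let $M=\prod_{n\ge 2}^{\ell^\infty} M_n(\mathbb{C})$ be the von Neumann algebra of bounded sequences of matrices and $M^+$ its cone of positive elements. The set of weakly paveable elements of $M^+$ is norm dense in $M^+$.
   Context: For $n\ge 2$ let $M_n$ be the $n\times n$ complex matrices with the operator norm and $D_n\subset M_n$ the diagonal matrices. $M$ is the $\ell^\infty$-direct sum of the $M_n$, $n\ge 2$: its elements are sequences $a=\{a_n\}_{n\ge 2}$ with $a_n\in M_n$ and $\|a\|=\sup_n\|a_n\|<\infty$, with coordinatewise operations. $D\subset M$ is the subalgebra of those $a$ with $a_n\in D_n$ for all $n$. $\mathcal{P}:M\to D$ is the conditional expectation which replaces each $a_n$ by its diagonal part. Let $x_n\in M$ be the unit of $M_n$ viewed as a summand of $M$. An element $a\in M$ is compact if $\lim_{n\to\infty}\|x_na\|=0$; $K$ is the closed ideal of compact elements, and $\pi:M\to M/K$ is the quotient map (with the quotient $C^*$-norm on $M/K$). A non-compact element $x\in M^+$ is weakly paveable if there exist a natural number $m$ and projections $p_1,\dots,p_m\in D$ such that $\sum_j p_j=1$ and $\|\pi(p_j(x-\mathcal{P}(x))p_j)\|<\|\pi(x)\|$ for all $j=1,\dots,m$. *)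

theory Defs
  imports "HOL-Analysis.L2_Norm" "HOL-Algebra.Ideal"
    "Jordan_Normal_Form.Schur_Decomposition"
begin

definition euclid_norm :: "complex vec \<Rightarrow> real" where
  "euclid_norm v = L2_set (\<lambda>i. cmod (v $ i)) {..<dim_vec v}"

definition op_norm :: "complex mat \<Rightarrow> real" where
  "op_norm A = Sup {euclid_norm (A *\<^sub>v v) |v. v \<in> carrier_vec (dim_col A) \<and> euclid_norm v \<le> 1}"

text \<open>A sequence indexed by \<open>n \<ge> 2\<close> is a function that is extensional on \<open>{2..}\<close>, i.e. has
  the value \<^const>\<open>undefined\<close> at \<open>0\<close> and \<open>1\<close>, so that equality of functions is equality of
  sequences.\<close>

definition MM :: "(nat \<Rightarrow> complex mat) ring" where
  "MM = \<lparr>carrier = {a \<in> (\<Pi>\<^sub>E n\<in>{2..}. carrier_mat n n). bdd_above ((\<lambda>n. op_norm (a n)) ` {2..})},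
         monoid.mult = (\<lambda>a b. \<lambda>n\<in>{2..}. a n * b n),
         one = (\<lambda>n\<in>{2..}. 1\<^sub>m n),
         zero = (\<lambda>n\<in>{2..}. 0\<^sub>m n n),
         add = (\<lambda>a b. \<lambda>n\<in>{2..}. a n + b n)\<rparr>"

definition MM_norm :: "(nat \<Rightarrow> complex mat) \<Rightarrow> real" where
  "MM_norm a = (SUP n\<in>{2..}. op_norm (a n))"

definition MM_star :: "(nat \<Rightarrow> complex mat) \<Rightarrow> (nat \<Rightarrow> complex mat)" where
  "MM_star a = (\<lambda>n\<in>{2..}. mat_adjoint (a n))"

text \<open>Positivity in the C*-algebraic sense: \<open>x = y* y\<close> for some element \<open>y\<close>.\<close>

definition MM_pos :: "(nat \<Rightarrow> complex mat) set" where
  "MM_pos = {MM_star y \<otimes>\<^bsub>MM\<^esub> y |y. y \<in> carrier MM}"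

definition DD :: "(nat \<Rightarrow> complex mat) set" where
  "DD = {a \<in> carrier MM. \<forall>n\<ge>2. diagonal_mat (a n)}"

definition cond_exp :: "(nat \<Rightarrow> complex mat) \<Rightarrow> (nat \<Rightarrow> complex mat)" where
  "cond_exp a = (\<lambda>n\<in>{2..}. mat_diag n (\<lambda>i. a n $$ (i, i)))"

definition projections :: "(nat \<Rightarrow> complex mat) set" where
  "projections = {p \<in> carrier MM. MM_star p = p \<and> p \<otimes>\<^bsub>MM\<^esub> p = p}"

definition unit_at :: "nat \<Rightarrow> (nat \<Rightarrow> complex mat)" where
  "unit_at n = (\<lambda>k\<in>{2..}. if k = n then 1\<^sub>m k else 0\<^sub>m k k)"

definition KK :: "(nat \<Rightarrow> complex mat) set" where
  "KK = {a \<in> carrier MM. (\<lambda>n. MM_norm (unit_at n \<otimes>\<^bsub>MM\<^esub> a)) \<longlonglongrightarrow> 0}"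

text \<open>Elements of \<open>M/K\<close> are the cosets \<open>K + a\<close>; the quotient norm is the infimum of the norm
  over the coset.\<close>

definition quot_map :: "(nat \<Rightarrow> complex mat) \<Rightarrow> (nat \<Rightarrow> complex mat) set" where
  "quot_map a = KK +>\<^bsub>MM\<^esub> a"

definition quot_norm :: "(nat \<Rightarrow> complex mat) set \<Rightarrow> real" where
  "quot_norm C = (INF a\<in>C. MM_norm a)"

definition weakly_paveable :: "(nat \<Rightarrow> complex mat) \<Rightarrow> bool" where
  "weakly_paveable x \<longleftrightarrow> x \<in> MM_pos \<and> x \<notin> KK \<and>
     (\<exists>(m::nat) p. (\<forall>j\<in>{1..m}. p j \<in> projections \<inter> DD) \<and>
        finsum MM p {1..m} = \<one>\<^bsub>MM\<^esub> \<and>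
        (\<forall>j\<in>{1..m}. quot_norm (quot_map (p j \<otimes>\<^bsub>MM\<^esub> (x \<ominus>\<^bsub>MM\<^esub> cond_exp x) \<otimes>\<^bsub>MM\<^esub> p j))
                    < quot_norm (quot_map x)))"

text \<open>\<^const>\<open>finsum\<close>, \<^const>\<open>a_minus\<close> and \<^const>\<open>a_r_coset\<close> have their intended meaning only
  because \<^const>\<open>MM\<close> is a ring and \<^const>\<open>KK\<close> is an additive subgroup of it; both are shown
  below.\<close>

lemma euclid_norm_nonneg: "0 \<le> euclid_norm v"
  by (simp add: euclid_norm_def L2_set_nonneg)

lemma euclid_norm_add:
  assumes "v \<in> carrier_vec n" "w \<in> carrier_vec n"
  shows "euclid_norm (v + w) \<le> euclid_norm v + euclid_norm w"
proof -
  have "L2_set (\<lambda>i. cmod ((v + w) $ i)) {..<n}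
      \<le> L2_set (\<lambda>i. cmod (v $ i) + cmod (w $ i)) {..<n}"
    using assms by (intro L2_set_mono) (auto simp: norm_triangle_ineq)
  also have "\<dots> \<le> L2_set (\<lambda>i. cmod (v $ i)) {..<n} + L2_set (\<lambda>i. cmod (w $ i)) {..<n}"
    by (rule L2_set_triangle_ineq)
  finally show ?thesis using assms by (simp add: euclid_norm_def)
qed

lemma euclid_norm_smult: "euclid_norm (c \<cdot>\<^sub>v v) = cmod c * euclid_norm v"
proof -
  have "euclid_norm (c \<cdot>\<^sub>v v) = L2_set (\<lambda>i. cmod c * cmod (v $ i)) {..<dim_vec v}"
    unfolding euclid_norm_def by (intro L2_set_cong) (auto simp: norm_mult)
  then show ?thesis by (simp add: euclid_norm_def L2_set_right_distrib)
qed

lemma euclid_norm_zero: "euclid_norm (0\<^sub>v n) = 0"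
  by (simp add: euclid_norm_def L2_set_def)

lemma euclid_norm_eq_0:
  assumes "euclid_norm v = 0" shows "v = 0\<^sub>v (dim_vec v)"
  using assms by (intro eq_vecI) (auto simp: euclid_norm_def L2_set_eq_0_iff)

lemma cmod_le_euclid_norm: "i < dim_vec v \<Longrightarrow> cmod (v $ i) \<le> euclid_norm v"
  unfolding euclid_norm_def by (rule member_le_L2_set) auto

lemma op_norm_bdd:
  "bdd_above {euclid_norm (A *\<^sub>v v) |v. v \<in> carrier_vec (dim_col A) \<and> euclid_norm v \<le> 1}"
proof (rule bdd_aboveI)
  fix r assume "r \<in> {euclid_norm (A *\<^sub>v v) |v. v \<in> carrier_vec (dim_col A) \<and> euclid_norm v \<le> 1}"
  then obtain v where v: "v \<in> carrier_vec (dim_col A)" "euclid_norm v \<le> 1"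
    and r: "r = euclid_norm (A *\<^sub>v v)" by auto
  have vi: "cmod (v $ i) \<le> 1" if "i < dim_col A" for i
    using cmod_le_euclid_norm[of i v] v that by auto
  have "r \<le> (\<Sum>i<dim_row A. cmod ((A *\<^sub>v v) $ i))"
    unfolding r euclid_norm_def by (rule order_trans[OF L2_set_le_sum]) auto
  also have "\<dots> \<le> (\<Sum>i<dim_row A. \<Sum>j<dim_col A. cmod (A $$ (i,j)))"
  proof (rule sum_mono)
    fix i assume i: "i \<in> {..<dim_row A}"
    have "cmod ((A *\<^sub>v v) $ i) = cmod (\<Sum>j<dim_col A. A $$ (i,j) * v $ j)"
      using i v by (auto simp: scalar_prod_def atLeast0LessThan intro!: arg_cong[where f=cmod] sum.cong)
    also have "\<dots> \<le> (\<Sum>j<dim_col A. cmod (A $$ (i,j)))"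
    proof (rule sum_norm_le)
      fix j assume "j \<in> {..<dim_col A}"
      then show "cmod (A $$ (i,j) * v $ j) \<le> cmod (A $$ (i,j))"
        using mult_left_mono[OF vi[of j], of "cmod (A $$ (i,j))"] by (simp add: norm_mult)
    qed
    finally show "cmod ((A *\<^sub>v v) $ i) \<le> (\<Sum>j<dim_col A. cmod (A $$ (i,j)))" .
  qed
  finally show "r \<le> (\<Sum>i<dim_row A. \<Sum>j<dim_col A. cmod (A $$ (i,j)))" .
qed

lemma op_norm_upper:
  assumes "v \<in> carrier_vec (dim_col A)" "euclid_norm v \<le> 1"
  shows "euclid_norm (A *\<^sub>v v) \<le> op_norm A"
  unfolding op_norm_def using assms by (intro cSup_upper op_norm_bdd) auto

lemma op_norm_least:
  assumes "\<And>v. v \<in> carrier_vec (dim_col A) \<Longrightarrow> euclid_norm v \<le> 1 \<Longrightarrow> euclid_norm (A *\<^sub>v v) \<le> c"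
  shows "op_norm A \<le> c"
  unfolding op_norm_def
proof (rule cSup_least)
  have "euclid_norm (A *\<^sub>v 0\<^sub>v (dim_col A)) \<in>
      {euclid_norm (A *\<^sub>v v) |v. v \<in> carrier_vec (dim_col A) \<and> euclid_norm v \<le> 1}"
    by (auto simp: euclid_norm_zero intro!: exI[of _ "0\<^sub>v (dim_col A)"])
  then show "{euclid_norm (A *\<^sub>v v) |v. v \<in> carrier_vec (dim_col A) \<and> euclid_norm v \<le> 1} \<noteq> {}"
    by blast
qed (use assms in auto)

lemma op_norm_nonneg: "0 \<le> op_norm A"
  using op_norm_upper[of "0\<^sub>v (dim_col A)" A] euclid_norm_nonneg[of "A *\<^sub>v 0\<^sub>v (dim_col A)"]
  by (simp add: euclid_norm_zero)

lemma op_norm_bound: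
  assumes "v \<in> carrier_vec (dim_col A)"
  shows "euclid_norm (A *\<^sub>v v) \<le> op_norm A * euclid_norm v"
proof (cases "euclid_norm v = 0")
  case True
  then have "v = 0\<^sub>v (dim_col A)" using euclid_norm_eq_0[OF True] assms by auto
  then have "A *\<^sub>v v = 0\<^sub>v (dim_row A)" by (intro eq_vecI) auto
  then show ?thesis using True by (simp add: euclid_norm_zero)
next
  case False
  then have pos: "euclid_norm v > 0" using euclid_norm_nonneg[of v] by simp
  define c where "c = complex_of_real (1 / euclid_norm v)"
  have c: "cmod c = 1 / euclid_norm v" using pos by (simp add: c_def norm_divide)
  have "euclid_norm (A *\<^sub>v (c \<cdot>\<^sub>v v)) \<le> op_norm A"
    using assms pos by (intro op_norm_upper) (auto simp: euclid_norm_smult c)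
  moreover have "A *\<^sub>v (c \<cdot>\<^sub>v v) = c \<cdot>\<^sub>v (A *\<^sub>v v)"
    using assms by (intro mult_mat_vec[of _ "dim_row A" "dim_col A"]) auto
  ultimately show ?thesis using pos by (simp add: euclid_norm_smult c field_simps)
qed

lemma op_norm_add:
  assumes "A \<in> carrier_mat n n" "B \<in> carrier_mat n n"
  shows "op_norm (A + B) \<le> op_norm A + op_norm B"
proof (rule op_norm_least)
  fix v assume v: "v \<in> carrier_vec (dim_col (A + B))" "euclid_norm v \<le> 1"
  then have vn: "v \<in> carrier_vec n" using assms by auto
  have "euclid_norm ((A + B) *\<^sub>v v) = euclid_norm (A *\<^sub>v v + B *\<^sub>v v)"
    using assms vn by (simp add: add_mult_distrib_mat_vec)
  also have "\<dots> \<le> euclid_norm (A *\<^sub>v v) + euclid_norm (B *\<^sub>v v)"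
    using assms vn by (intro euclid_norm_add[of _ n] mult_mat_vec_carrier)
  also have "\<dots> \<le> op_norm A + op_norm B"
    using assms vn v by (intro add_mono op_norm_upper) auto
  finally show "euclid_norm ((A + B) *\<^sub>v v) \<le> op_norm A + op_norm B" .
qed

lemma op_norm_mult:
  assumes "A \<in> carrier_mat n n" "B \<in> carrier_mat n n"
  shows "op_norm (A * B) \<le> op_norm A * op_norm B"
proof (rule op_norm_least)
  fix v assume v: "v \<in> carrier_vec (dim_col (A * B))" "euclid_norm v \<le> 1"
  then have vn: "v \<in> carrier_vec n" using assms by auto
  have "euclid_norm ((A * B) *\<^sub>v v) = euclid_norm (A *\<^sub>v (B *\<^sub>v v))"
    using assms vn by (simp add: assoc_mult_mat_vec)
  also have "\<dots> \<le> op_norm A * euclid_norm (B *\<^sub>v v)"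
    using assms vn by (intro op_norm_bound) auto
  also have "\<dots> \<le> op_norm A * op_norm B"
    using assms vn v by (intro mult_left_mono op_norm_upper op_norm_nonneg) auto
  finally show "euclid_norm ((A * B) *\<^sub>v v) \<le> op_norm A * op_norm B" .
qed

lemma op_norm_uminus:
  assumes "A \<in> carrier_mat n n"
  shows "op_norm (- A) = op_norm A"
proof -
  have "euclid_norm (- A *\<^sub>v v) = euclid_norm (A *\<^sub>v v)" if "v \<in> carrier_vec n" for v
  proof -
    have "- A *\<^sub>v v = (-1) \<cdot>\<^sub>v (A *\<^sub>v v)"
      using assms that by (intro eq_vecI) (auto simp: uminus_mult_mat_vec)
    then show ?thesis by (simp add: euclid_norm_smult)
  qed
  then have "{euclid_norm (- A *\<^sub>v v) |v. v \<in> carrier_vec (dim_col (- A)) \<and> euclid_norm v \<le> 1}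
     = {euclid_norm (A *\<^sub>v v) |v. v \<in> carrier_vec (dim_col A) \<and> euclid_norm v \<le> 1}"
    using assms by (auto; metis)
  then show ?thesis by (simp only: op_norm_def)
qed

lemma op_norm_zero: "op_norm (0\<^sub>m n n) = 0"
proof (rule antisym)
  show "op_norm (0\<^sub>m n n) \<le> 0"
  proof (rule op_norm_least)
    fix v :: "complex vec" assume v: "v \<in> carrier_vec (dim_col (0\<^sub>m n n :: complex mat))"
    then have "0\<^sub>m n n *\<^sub>v v = 0\<^sub>v n" by (intro eq_vecI) auto
    then show "euclid_norm (0\<^sub>m n n *\<^sub>v v) \<le> 0" by (simp add: euclid_norm_zero)
  qed
qed (rule op_norm_nonneg)

lemma op_norm_one: "op_norm (1\<^sub>m n) \<le> 1"
  by (rule op_norm_least) auto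

lemma MM_carrierD:
  assumes "a \<in> carrier MM"
  shows "n \<ge> 2 \<Longrightarrow> a n \<in> carrier_mat n n" "a \<in> extensional {2..}"
    "bdd_above ((\<lambda>n. op_norm (a n)) ` {2..})"
  using assms by (auto simp: MM_def PiE_def Pi_def)

lemma MM_carrierI:
  assumes "\<And>n. n \<ge> 2 \<Longrightarrow> a n \<in> carrier_mat n n" "a \<in> extensional {2..}"
    "\<And>n. n \<ge> 2 \<Longrightarrow> op_norm (a n) \<le> c"
  shows "a \<in> carrier MM"
  using assms by (auto simp: MM_def PiE_def intro!: bdd_aboveI[where M = c])

lemma op_norm_le_MM_norm: "a \<in> carrier MM \<Longrightarrow> n \<ge> 2 \<Longrightarrow> op_norm (a n) \<le> MM_norm a"
  unfolding MM_norm_def by (rule cSUP_upper) (auto dest: MM_carrierD)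

lemma MM_norm_le: "(\<And>n. n \<ge> 2 \<Longrightarrow> op_norm (a n) \<le> c) \<Longrightarrow> MM_norm a \<le> c"
  unfolding MM_norm_def by (rule cSUP_least) auto

lemma MM_add_closed:
  assumes "a \<in> carrier MM" "b \<in> carrier MM"
  shows "a \<oplus>\<^bsub>MM\<^esub> b \<in> carrier MM"
proof (rule MM_carrierI[where c = "MM_norm a + MM_norm b"])
  show "op_norm ((a \<oplus>\<^bsub>MM\<^esub> b) n) \<le> MM_norm a + MM_norm b" if "n \<ge> 2" for n
    using op_norm_add[of "a n" n "b n"] op_norm_le_MM_norm[OF assms(1) that]
      op_norm_le_MM_norm[OF assms(2) that] MM_carrierD(1)[OF assms(1) that]
      MM_carrierD(1)[OF assms(2) that] that
    by (simp add: MM_def)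
qed (use MM_carrierD(1)[OF assms(1)] MM_carrierD(1)[OF assms(2)] in \<open>auto simp: MM_def\<close>)

lemma MM_mult_closed:
  assumes "a \<in> carrier MM" "b \<in> carrier MM"
  shows "a \<otimes>\<^bsub>MM\<^esub> b \<in> carrier MM"
proof (rule MM_carrierI[where c = "MM_norm a * MM_norm b"])
  show "op_norm ((a \<otimes>\<^bsub>MM\<^esub> b) n) \<le> MM_norm a * MM_norm b" if n: "n \<ge> 2" for n
  proof -
    have "op_norm (a n * b n) \<le> op_norm (a n) * op_norm (b n)"
      using assms n by (intro op_norm_mult[of _ n]) (auto dest: MM_carrierD)
    also have "\<dots> \<le> MM_norm a * MM_norm b"
      using op_norm_le_MM_norm[OF assms(1) n] op_norm_le_MM_norm[OF assms(2) n]
        op_norm_nonneg[of "a n"] op_norm_nonneg[of "b n"]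
      by (intro mult_mono) auto
    finally show ?thesis using n by (simp add: MM_def)
  qed
qed (use MM_carrierD(1)[OF assms(1)] MM_carrierD(1)[OF assms(2)] in \<open>auto simp: MM_def intro!: mult_carrier_mat\<close>)

lemma MM_one_closed: "\<one>\<^bsub>MM\<^esub> \<in> carrier MM"
  by (rule MM_carrierI[where c = 1]) (auto simp: MM_def op_norm_one)

lemma MM_zero_closed: "\<zero>\<^bsub>MM\<^esub> \<in> carrier MM"
  by (rule MM_carrierI[where c = 0]) (auto simp: MM_def op_norm_zero)

lemma MM_uminus_closed:
  assumes "a \<in> carrier MM"
  shows "(\<lambda>n\<in>{2..}. - a n) \<in> carrier MM"
  using MM_carrierD(1)[OF assms] op_norm_le_MM_norm[OF assms]
  by (intro MM_carrierI[where c = "MM_norm a"]) (auto simp: op_norm_uminus[OF MM_carrierD(1)[OF assms]])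

lemma MM_ext:
  assumes "a \<in> carrier MM" "b \<in> carrier MM" "\<And>n. n \<ge> 2 \<Longrightarrow> a n = b n"
  shows "a = b"
  using MM_carrierD(2)[OF assms(1)] MM_carrierD(2)[OF assms(2)] assms(3)
  by (intro extensionalityI[of a "{2..}" b]) auto

lemma MM_ops:
  assumes "n \<ge> 2"
  shows "(a \<oplus>\<^bsub>MM\<^esub> b) n = a n + b n" "(a \<otimes>\<^bsub>MM\<^esub> b) n = a n * b n"
    "\<one>\<^bsub>MM\<^esub> n = 1\<^sub>m n" "\<zero>\<^bsub>MM\<^esub> n = 0\<^sub>m n n"
  using assms by (simp_all add: MM_def)

theorem ring_MM: "ring MM"
proof (rule ringI)
  note cl = MM_add_closed MM_mult_closed MM_one_closed MM_zero_closed
  show "abelian_group MM"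
  proof (rule abelian_groupI)
    fix a b c assume abc: "a \<in> carrier MM" "b \<in> carrier MM" "c \<in> carrier MM"
    show "a \<oplus>\<^bsub>MM\<^esub> b \<oplus>\<^bsub>MM\<^esub> c = a \<oplus>\<^bsub>MM\<^esub> (b \<oplus>\<^bsub>MM\<^esub> c)"
      using abc by (intro MM_ext cl) (auto simp: MM_ops assoc_add_mat dest!: MM_carrierD(1))
  next
    fix a b assume ab: "a \<in> carrier MM" "b \<in> carrier MM"
    show "a \<oplus>\<^bsub>MM\<^esub> b = b \<oplus>\<^bsub>MM\<^esub> a"
      using ab by (intro MM_ext cl) (auto simp: MM_ops intro!: comm_add_mat dest!: MM_carrierD(1))
  next
    fix a assume a: "a \<in> carrier MM"
    show "\<zero>\<^bsub>MM\<^esub> \<oplus>\<^bsub>MM\<^esub> a = a"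
      using a MM_carrierD(1)[OF a] by (intro MM_ext cl) (auto simp: MM_ops)
    have "(\<lambda>n\<in>{2..}. - a n) \<oplus>\<^bsub>MM\<^esub> a = \<zero>\<^bsub>MM\<^esub>"
      using a MM_carrierD(1)[OF a]
      by (intro MM_ext cl MM_uminus_closed) (auto simp: MM_ops uminus_l_inv_mat)
    then show "\<exists>b\<in>carrier MM. b \<oplus>\<^bsub>MM\<^esub> a = \<zero>\<^bsub>MM\<^esub>"
      using MM_uminus_closed[OF a] by blast
  qed (auto intro: cl)
  show "monoid MM"
  proof (rule monoidI)
    fix a b c assume abc: "a \<in> carrier MM" "b \<in> carrier MM" "c \<in> carrier MM"
    show "a \<otimes>\<^bsub>MM\<^esub> b \<otimes>\<^bsub>MM\<^esub> c = a \<otimes>\<^bsub>MM\<^esub> (b \<otimes>\<^bsub>MM\<^esub> c)"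
      using abc by (intro MM_ext cl) (auto simp: MM_ops intro!: assoc_mult_mat dest!: MM_carrierD(1))
  next
    fix a assume a: "a \<in> carrier MM"
    show "\<one>\<^bsub>MM\<^esub> \<otimes>\<^bsub>MM\<^esub> a = a" "a \<otimes>\<^bsub>MM\<^esub> \<one>\<^bsub>MM\<^esub> = a"
      using a by (auto intro!: MM_ext cl simp: MM_ops left_mult_one_mat[OF MM_carrierD(1)[OF a]]
          right_mult_one_mat[OF MM_carrierD(1)[OF a]])
  qed (auto intro: cl)
  fix a b c assume abc: "a \<in> carrier MM" "b \<in> carrier MM" "c \<in> carrier MM"
  show "(a \<oplus>\<^bsub>MM\<^esub> b) \<otimes>\<^bsub>MM\<^esub> c = a \<otimes>\<^bsub>MM\<^esub> c \<oplus>\<^bsub>MM\<^esub> b \<otimes>\<^bsub>MM\<^esub> c"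
    using abc by (intro MM_ext cl) (auto simp: MM_ops intro!: add_mult_distrib_mat dest!: MM_carrierD(1))
  show "c \<otimes>\<^bsub>MM\<^esub> (a \<oplus>\<^bsub>MM\<^esub> b) = c \<otimes>\<^bsub>MM\<^esub> a \<oplus>\<^bsub>MM\<^esub> c \<otimes>\<^bsub>MM\<^esub> b"
    using abc by (intro MM_ext cl) (auto simp: MM_ops intro!: mult_add_distrib_mat dest!: MM_carrierD(1))
qed

lemma MM_a_inv:
  assumes "a \<in> carrier MM"
  shows "\<ominus>\<^bsub>MM\<^esub> a = (\<lambda>n\<in>{2..}. - a n)"
proof -
  interpret ring MM by (rule ring_MM)
  have "(\<lambda>n\<in>{2..}. - a n) \<oplus>\<^bsub>MM\<^esub> a = \<zero>\<^bsub>MM\<^esub>"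
    using assms MM_carrierD(1)[OF assms]
    by (intro MM_ext MM_add_closed MM_zero_closed MM_uminus_closed) (auto simp: MM_ops uminus_l_inv_mat)
  then show ?thesis using assms MM_uminus_closed[OF assms] minus_equality by blast
qed

lemma unit_at_closed: "unit_at n \<in> carrier MM"
  by (rule MM_carrierI[where c = 1]) (auto simp: unit_at_def op_norm_one op_norm_zero)

lemma MM_norm_unit_at:
  assumes a: "a \<in> carrier MM" and n: "n \<ge> 2"
  shows "MM_norm (unit_at n \<otimes>\<^bsub>MM\<^esub> a) = op_norm (a n)"
proof (rule antisym)
  show "MM_norm (unit_at n \<otimes>\<^bsub>MM\<^esub> a) \<le> op_norm (a n)"
  proof (rule MM_norm_le)
    fix k :: nat assume "k \<ge> 2"
    then show "op_norm ((unit_at n \<otimes>\<^bsub>MM\<^esub> a) k) \<le> op_norm (a n)"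
      by (auto simp: MM_ops unit_at_def op_norm_zero op_norm_nonneg
          left_mult_one_mat[OF MM_carrierD(1)[OF a]] left_mult_zero_mat[OF MM_carrierD(1)[OF a]])
  qed
  show "op_norm (a n) \<le> MM_norm (unit_at n \<otimes>\<^bsub>MM\<^esub> a)"
    using op_norm_le_MM_norm[OF MM_mult_closed[OF unit_at_closed a] n, of n] n MM_carrierD(1)[OF a n]
    by (simp add: MM_ops unit_at_def)
qed

lemma KK_iff: "a \<in> KK \<longleftrightarrow> a \<in> carrier MM \<and> (\<lambda>n. op_norm (a n)) \<longlonglongrightarrow> 0"
proof -
  have "(\<lambda>n. MM_norm (unit_at n \<otimes>\<^bsub>MM\<^esub> a)) \<longlonglongrightarrow> 0 \<longleftrightarrow> (\<lambda>n. op_norm (a n)) \<longlonglongrightarrow> 0"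
    if "a \<in> carrier MM"
    by (rule tendsto_cong) (auto simp: eventually_sequentially MM_norm_unit_at[OF that] intro!: exI[of _ 2])
  then show ?thesis by (auto simp: KK_def)
qed

theorem ideal_KK: "ideal KK MM"
proof -
  interpret R: ring MM by (rule ring_MM)
  have add: "a \<oplus>\<^bsub>MM\<^esub> b \<in> KK" if "a \<in> KK" "b \<in> KK" for a b
  proof -
    have ab: "a \<in> carrier MM" "b \<in> carrier MM"
      and lim: "(\<lambda>n. op_norm (a n)) \<longlonglongrightarrow> 0" "(\<lambda>n. op_norm (b n)) \<longlonglongrightarrow> 0"
      using that by (auto simp: KK_iff)
    have "(\<lambda>n. op_norm ((a \<oplus>\<^bsub>MM\<^esub> b) n)) \<longlonglongrightarrow> 0"
    proof (rule tendsto_sandwich[OF _ _ tendsto_const])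
      show "(\<lambda>n. op_norm (a n) + op_norm (b n)) \<longlonglongrightarrow> 0" using tendsto_add[OF lim] by simp
      show "\<forall>\<^sub>F n in sequentially. op_norm ((a \<oplus>\<^bsub>MM\<^esub> b) n) \<le> op_norm (a n) + op_norm (b n)"
        unfolding eventually_sequentially
        using MM_carrierD(1)[OF ab(1)] MM_carrierD(1)[OF ab(2)]
        by (intro exI[of _ 2]) (auto simp: MM_ops intro!: op_norm_add)
    qed (auto simp: op_norm_nonneg)
    then show ?thesis using ab by (simp add: KK_iff)
  qed
  have mult: "x \<otimes>\<^bsub>MM\<^esub> a \<in> KK \<and> a \<otimes>\<^bsub>MM\<^esub> x \<in> KK" if "a \<in> KK" "x \<in> carrier MM" for a x
  proof -
    have a: "a \<in> carrier MM" and lim: "(\<lambda>n. op_norm (a n)) \<longlonglongrightarrow> 0"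
      using that by (auto simp: KK_iff)
    have lim': "(\<lambda>n. MM_norm x * op_norm (a n)) \<longlonglongrightarrow> 0" using tendsto_mult_left[OF lim] by simp
    have le: "op_norm (x n * a n) \<le> MM_norm x * op_norm (a n)"
      "op_norm (a n * x n) \<le> MM_norm x * op_norm (a n)" if n: "n \<ge> 2" for n
    proof -
      note c = MM_carrierD(1)[OF a n] MM_carrierD(1)[OF \<open>x \<in> carrier MM\<close> n]
      have "op_norm (x n) * op_norm (a n) \<le> MM_norm x * op_norm (a n)"
        using op_norm_le_MM_norm[OF \<open>x \<in> carrier MM\<close> n]
        by (intro mult_right_mono op_norm_nonneg)
      then show "op_norm (x n * a n) \<le> MM_norm x * op_norm (a n)"
        "op_norm (a n * x n) \<le> MM_norm x * op_norm (a n)"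
        using op_norm_mult[OF c] op_norm_mult[OF c(2) c(1)] by (auto simp: mult.commute)
    qed
    have "(\<lambda>n. op_norm ((x \<otimes>\<^bsub>MM\<^esub> a) n)) \<longlonglongrightarrow> 0"
    proof (rule tendsto_sandwich[OF _ _ tendsto_const lim'])
      show "\<forall>\<^sub>F n in sequentially. op_norm ((x \<otimes>\<^bsub>MM\<^esub> a) n) \<le> MM_norm x * op_norm (a n)"
        unfolding eventually_sequentially using le by (intro exI[of _ 2]) (auto simp: MM_ops)
    qed (auto simp: op_norm_nonneg)
    moreover have "(\<lambda>n. op_norm ((a \<otimes>\<^bsub>MM\<^esub> x) n)) \<longlonglongrightarrow> 0"
    proof (rule tendsto_sandwich[OF _ _ tendsto_const lim'])
      show "\<forall>\<^sub>F n in sequentially. op_norm ((a \<otimes>\<^bsub>MM\<^esub> x) n) \<le> MM_norm x * op_norm (a n)"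
        unfolding eventually_sequentially using le by (intro exI[of _ 2]) (auto simp: MM_ops)
    qed (auto simp: op_norm_nonneg)
    ultimately show ?thesis using a \<open>x \<in> carrier MM\<close> by (simp add: KK_iff)
  qed
  have zero: "\<zero>\<^bsub>MM\<^esub> \<in> KK"
  proof -
    have "(\<lambda>n. op_norm (\<zero>\<^bsub>MM\<^esub> n)) \<longlonglongrightarrow> 0"
      by (rule tendsto_eventually)
        (auto simp: eventually_sequentially MM_ops op_norm_zero intro!: exI[of _ 2])
    then show ?thesis by (simp add: KK_iff)
  qed
  have inv: "\<ominus>\<^bsub>MM\<^esub> a \<in> KK" if "a \<in> KK" for a
  proof -
    have a: "a \<in> carrier MM" using that by (simp add: KK_iff)
    have "\<ominus>\<^bsub>MM\<^esub> a = (\<ominus>\<^bsub>MM\<^esub> \<one>\<^bsub>MM\<^esub>) \<otimes>\<^bsub>MM\<^esub> a" using a by (simp add: R.l_minus)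
    then show ?thesis using mult[OF that, of "\<ominus>\<^bsub>MM\<^esub> \<one>\<^bsub>MM\<^esub>"] by simp
  qed
  show ?thesis
  proof (rule idealI[OF ring_MM])
    show "subgroup KK (add_monoid MM)"
      using zero add inv by unfold_locales (auto simp: KK_iff a_inv_def)
  qed (use mult in auto)
qed

end

theory Submission
  imports Defs
begin

text \<open>If \<open>a \<ge> 0\<close> and \<open>\<delta> > 0\<close>, then \<open>x = a + \<delta> 1\<close> is weakly paveable already with \<open>m = 1\<close> and
  \<open>p\<^sub>1 = 1\<close>: both \<open>x\<close> and its diagonal lie between \<open>\<delta>\<close> and \<open>\<parallel>x\<parallel>\<close> in every coordinate, so that
  \<open>\<parallel>x\<^sub>n - P x\<^sub>n\<parallel> \<le> \<parallel>x\<^sub>n\<parallel> - \<delta>\<close>, and this uniform gap survives in the quotient. That \<open>x\<close> has the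
  form \<open>y* y\<close> comes from a Cholesky factorisation of each coordinate.\<close>

section \<open>Adjoints and the inner product of complex vectors\<close>

lemma mat_adjoint_dim [simp]:
  "dim_row (mat_adjoint A) = dim_col A" "dim_col (mat_adjoint A) = dim_row A"
  by (simp_all add: mat_adjoint_def)

lemma mat_adjoint_index [simp]:
  assumes "i < dim_col A" "j < dim_row A"
  shows "mat_adjoint A $$ (i, j) = conjugate (A $$ (j, i))"
  using assms by (simp add: mat_adjoint_def mat_of_rows_def)

lemma mat_adjoint_carrier:
  "A \<in> carrier_mat m n \<Longrightarrow> mat_adjoint A \<in> carrier_mat n m"
  by (auto intro: carrier_matI)

lemma cscalar_prod_sum:
  fixes v w :: "complex vec"
  assumes "w \<in> carrier_vec n"
  shows "v \<bullet>c w = (\<Sum>i<n. v $ i * cnj (w $ i))"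
  using assms by (simp add: scalar_prod_def atLeast0LessThan)

lemma cnj_cscalar_prod:
  fixes v w :: "complex vec"
  assumes "v \<in> carrier_vec n" "w \<in> carrier_vec n"
  shows "cnj (v \<bullet>c w) = w \<bullet>c v"
  using assms by (simp add: cscalar_prod_sum[where n = n] mult.commute)

lemma mult_mat_vec_sum:
  assumes "A \<in> carrier_mat m n" "v \<in> carrier_vec n" "i < m"
  shows "(A *\<^sub>v v) $ i = (\<Sum>j<n. A $$ (i, j) * v $ j)"
  using assms by (simp add: scalar_prod_def atLeast0LessThan)

lemma mult_adjoint_index:
  fixes B :: "complex mat"
  assumes "B \<in> carrier_mat n n" "i < n" "j < n"
  shows "(mat_adjoint B * B) $$ (i, j) = (\<Sum>k<n. cnj (B $$ (k, i)) * B $$ (k, j))"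
  using assms by (simp add: scalar_prod_def atLeast0LessThan)

lemma cscalar_prod_mult_mat_vec:
  fixes A :: "complex mat"
  assumes "A \<in> carrier_mat m n" "v \<in> carrier_vec n" "w \<in> carrier_vec m"
  shows "(A *\<^sub>v v) \<bullet>c w = v \<bullet>c (mat_adjoint A *\<^sub>v w)"
proof -
  have "(A *\<^sub>v v) \<bullet>c w = (\<Sum>i<m. \<Sum>j<n. A $$ (i, j) * v $ j * cnj (w $ i))"
    using assms by (simp del: index_mult_mat_vec
        add: cscalar_prod_sum mult_mat_vec_sum[OF assms(1,2)] sum_distrib_right)
  also have "\<dots> = (\<Sum>j<n. \<Sum>i<m. A $$ (i, j) * v $ j * cnj (w $ i))"
    by (rule sum.swap)
  also have "\<dots> = v \<bullet>c (mat_adjoint A *\<^sub>v w)"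
    using assms mat_adjoint_carrier[OF assms(1)]
    by (simp del: index_mult_mat_vec add: cscalar_prod_sum[where n = n]
        mult_mat_vec_sum[where m = n and n = m] sum_distrib_left mult_ac)
  finally show ?thesis .
qed

lemma euclid_norm_sq: "(euclid_norm v)\<^sup>2 = (\<Sum>i<dim_vec v. (cmod (v $ i))\<^sup>2)"
  by (simp add: euclid_norm_def L2_set_def sum_nonneg)

lemma cscalar_prod_self: "v \<bullet>c v = complex_of_real ((euclid_norm v)\<^sup>2)"
  by (simp add: cscalar_prod_sum[of v "dim_vec v"] euclid_norm_sq complex_mult_cnj cmod_def)

lemma cmod_cscalar_prod_le:
  fixes v w :: "complex vec"
  assumes "v \<in> carrier_vec n" "w \<in> carrier_vec n"
  shows "cmod (v \<bullet>c w) \<le> euclid_norm v * euclid_norm w"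
proof -
  have "cmod (v \<bullet>c w) \<le> (\<Sum>i<n. \<bar>cmod (v $ i)\<bar> * \<bar>cmod (w $ i)\<bar>)"
    unfolding cscalar_prod_sum[OF assms(2)] by (rule sum_norm_le) (simp add: norm_mult)
  also have "\<dots> \<le> euclid_norm v * euclid_norm w"
    using assms L2_set_mult_ineq[of "\<lambda>i. cmod (v $ i)" "\<lambda>i. cmod (w $ i)" "{..<n}"]
    by (simp add: euclid_norm_def)
  finally show ?thesis .
qed

lemma parallelogram_euclid_norm:
  assumes "v \<in> carrier_vec n" "w \<in> carrier_vec n"
  shows "(euclid_norm (v + w))\<^sup>2 + (euclid_norm (v - w))\<^sup>2
    = 2 * (euclid_norm v)\<^sup>2 + 2 * (euclid_norm w)\<^sup>2"
proof -
  have "(cmod (z + u))\<^sup>2 + (cmod (z - u))\<^sup>2 = 2 * (cmod z)\<^sup>2 + 2 * (cmod u)\<^sup>2" for z u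
    unfolding cmod_power2 by (simp add: power2_eq_square algebra_simps)
  then have "(\<Sum>i<n. (cmod (v $ i + w $ i))\<^sup>2 + (cmod (v $ i - w $ i))\<^sup>2)
      = (\<Sum>i<n. 2 * (cmod (v $ i))\<^sup>2 + 2 * (cmod (w $ i))\<^sup>2)"
    by (intro sum.cong) auto
  then show ?thesis
    using assms by (simp add: euclid_norm_sq sum.distrib sum_distrib_left)
qed

text \<open>The products \<open>v\<close> with \<open>x\<close> and \<open>w\<close> with
  \<open>y\<close> cancel, so only the cross terms survive. With \<open>v\<close>, \<open>w\<close>
  the images of \<open>x\<close>, \<open>y\<close> under a matrix, this recovers its sesquilinear
  form from its quadratic form.\<close>

lemma polarization:
  fixes v w x y :: "complex vec"
  assumes "v \<in> carrier_vec n" "w \<in> carrier_vec n" "x \<in> carrier_vec n" "y \<in> carrier_vec n"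
  shows "(v + w) \<bullet>c (x + y) - (v - w) \<bullet>c (x - y) = 2 * (v \<bullet>c y) + 2 * (w \<bullet>c x)"
proof -
  have "(v + w) \<bullet>c (x + y) - (v - w) \<bullet>c (x - y)
      = (\<Sum>i<n. (v $ i + w $ i) * cnj (x $ i + y $ i) - (v $ i - w $ i) * cnj (x $ i - y $ i))"
    using assms by (simp add: cscalar_prod_sum[where n = n] sum_subtractf)
  also have "\<dots> = (\<Sum>i<n. 2 * (v $ i * cnj (y $ i)) + 2 * (w $ i * cnj (x $ i)))"
    by (rule sum.cong) (auto simp: algebra_simps)
  also have "\<dots> = 2 * (v \<bullet>c y) + 2 * (w \<bullet>c x)"
    using assms by (simp add: cscalar_prod_sum[where n = n] sum.distrib sum_distrib_left)
  finally show ?thesis .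
qed

section \<open>Quadratic forms and operator norms\<close>

lemma cmod_quadratic_form_le:
  assumes "A \<in> carrier_mat n n" "v \<in> carrier_vec n"
  shows "cmod ((A *\<^sub>v v) \<bullet>c v) \<le> op_norm A * (euclid_norm v)\<^sup>2"
proof -
  have "cmod ((A *\<^sub>v v) \<bullet>c v) \<le> euclid_norm (A *\<^sub>v v) * euclid_norm v"
    using assms by (intro cmod_cscalar_prod_le[of _ n]) auto
  also have "\<dots> \<le> op_norm A * euclid_norm v * euclid_norm v"
    using assms by (intro mult_right_mono op_norm_bound euclid_norm_nonneg) auto
  finally show ?thesis by (simp add: power2_eq_square)
qed

lemma quadratic_form_unit_vec:
  fixes A :: "complex mat"
  assumes "A \<in> carrier_mat n n" "i < n"
  shows "(A *\<^sub>v unit_vec n i) \<bullet>c unit_vec n i = A $$ (i, i)"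
proof -
  have "conjugate (unit_vec n i :: complex vec) = unit_vec n i"
    by (intro eq_vecI) (auto simp: unit_vec_def)
  then show ?thesis using assms by (simp add: scalar_prod_right_unit)
qed

lemma euclid_norm_unit_vec: "i < n \<Longrightarrow> euclid_norm (unit_vec n i) = 1"
proof -
  assume i: "i < n"
  have "(euclid_norm (unit_vec n i))\<^sup>2 = (\<Sum>j<n. if j = i then 1 else 0)"
    unfolding euclid_norm_sq using i by (intro sum.cong) (auto simp: unit_vec_def)
  then show ?thesis using i euclid_norm_nonneg[of "unit_vec n i"] by (simp add: power2_eq_1_iff)
qed

text \<open>Testing the quadratic form on \<open>v + u\<close> and \<open>v - u\<close>, with
  \<open>u\<close> the unit vector along the image of \<open>v\<close>, isolates four times the norm
  of that image; the parallelogram law bounds the two values together by \<open>c * 4\<close>. This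
  is the fact that the norm of a Hermitian matrix equals its numerical radius.\<close>

lemma op_norm_hermitian_le:
  assumes H: "H \<in> carrier_mat n n" "mat_adjoint H = H"
    and q: "\<And>v. v \<in> carrier_vec n \<Longrightarrow> \<bar>Re ((H *\<^sub>v v) \<bullet>c v)\<bar> \<le> c * (euclid_norm v)\<^sup>2"
    and c: "0 \<le> c"
  shows "op_norm H \<le> c"
proof (rule op_norm_least)
  fix v assume "v \<in> carrier_vec (dim_col H)" and v1: "euclid_norm v \<le> 1"
  then have v: "v \<in> carrier_vec n" using H by auto
  define w where "w = H *\<^sub>v v"
  have w: "w \<in> carrier_vec n" using H v by (auto simp: w_def)
  show "euclid_norm (H *\<^sub>v v) \<le> c"
  proof (cases "euclid_norm w = 0")
    case False
    then have pos: "euclid_norm w > 0" using euclid_norm_nonneg[of w] by simp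
    define u where "u = complex_of_real (1 / euclid_norm w) \<cdot>\<^sub>v w"
    have u: "u \<in> carrier_vec n" using w by (simp add: u_def)
    have u1: "euclid_norm u = 1" using pos by (simp add: u_def euclid_norm_smult norm_divide)
    have Hu: "H *\<^sub>v u \<in> carrier_vec n" using H u by auto
    have vu: "(H *\<^sub>v v) \<bullet>c u = euclid_norm w"
    proof -
      have "w \<bullet>c u = cnj (1 / euclid_norm w) * (w \<bullet>c w)"
        using w by (simp add: u_def cscalar_prod_sum[where n = n] sum_distrib_left mult_ac)
      then show ?thesis using pos by (simp add: w_def cscalar_prod_self power2_eq_square)
    qed
    \<comment> \<open>Moving \<open>H\<close> to the other side gives the conjugate of the value in
      \<open>vu\<close>, and that value is real.\<close>
    have uv: "(H *\<^sub>v u) \<bullet>c v = euclid_norm w"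
      using cscalar_prod_mult_mat_vec[OF H(1) u v] H(2) cnj_cscalar_prod[OF w u] vu
      by (simp add: w_def)
    have "(H *\<^sub>v (v + u)) \<bullet>c (v + u) - (H *\<^sub>v (v - u)) \<bullet>c (v - u)
        = 2 * ((H *\<^sub>v v) \<bullet>c u) + 2 * ((H *\<^sub>v u) \<bullet>c v)"
      using polarization[of "H *\<^sub>v v" n "H *\<^sub>v u" v u] H u v w Hu
      by (simp add: mult_add_distrib_mat_vec mult_minus_distrib_mat_vec w_def)
    then have "4 * euclid_norm w
        = Re ((H *\<^sub>v (v + u)) \<bullet>c (v + u)) - Re ((H *\<^sub>v (v - u)) \<bullet>c (v - u))"
      unfolding vu uv by (simp flip: minus_complex.sel)
    also have "\<dots> \<le> c * ((euclid_norm (v + u))\<^sup>2 + (euclid_norm (v - u))\<^sup>2)"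
      using q[of "v + u"] q[of "v - u"] u v by (auto simp: distrib_left)
    also have "\<dots> = c * (2 * (euclid_norm v)\<^sup>2 + 2)"
      using u1 by (simp add: parallelogram_euclid_norm[OF v u])
    also have "\<dots> \<le> c * 4"
      using power_le_one[OF euclid_norm_nonneg v1, of 2] c by (intro mult_left_mono) auto
    finally show ?thesis by (simp add: w_def)
  qed (use c in \<open>simp add: w_def\<close>)
qed

lemma mat_diag_mult_vec_index:
  assumes "v \<in> carrier_vec n" "i < n"
  shows "(mat_diag n f *\<^sub>v v) $ i = f i * v $ i"
proof -
  have "(mat_diag n f *\<^sub>v v) $ i = (\<Sum>j<n. mat_diag n f $$ (i, j) * v $ j)"
    using assms by (intro mult_mat_vec_sum) (auto simp: mat_diag_def)
  also have "\<dots> = (\<Sum>j<n. if j = i then f i * v $ i else 0)"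
    using assms by (intro sum.cong) (auto simp: mat_diag_def)
  finally show ?thesis using assms by simp
qed

lemma op_norm_mat_diag_le:
  assumes "\<And>i. i < n \<Longrightarrow> cmod (f i) \<le> c" "0 \<le> c"
  shows "op_norm (mat_diag n f) \<le> c"
proof (rule op_norm_least)
  fix v assume "v \<in> carrier_vec (dim_col (mat_diag n f))" and v1: "euclid_norm v \<le> 1"
  then have v: "v \<in> carrier_vec n" by (simp add: mat_diag_def)
  have "euclid_norm (mat_diag n f *\<^sub>v v) \<le> L2_set (\<lambda>i. c * cmod (v $ i)) {..<n}"
  proof -
    have "L2_set (\<lambda>i. cmod ((mat_diag n f *\<^sub>v v) $ i)) {..<n}
        \<le> L2_set (\<lambda>i. c * cmod (v $ i)) {..<n}"
      using assms(1) v
      by (intro L2_set_mono) (auto simp del: index_mult_mat_vec simp: mat_diag_mult_vec_index norm_mult intro!: mult_right_mono)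
    then show ?thesis by (simp add: euclid_norm_def mat_diag_def)
  qed
  also have "\<dots> = c * euclid_norm v"
    using v assms(2) by (simp add: L2_set_right_distrib euclid_norm_def)
  also have "\<dots> \<le> c"
    using v1 assms(2) by (simp add: mult_left_le)
  finally show "euclid_norm (mat_diag n f *\<^sub>v v) \<le> c" .
qed

lemma hermitian_index:
  assumes "A \<in> carrier_mat n n" "mat_adjoint A = A" "i < n" "j < n"
  shows "A $$ (j, i) = conjugate (A $$ (i, j))"
proof -
  have "mat_adjoint A $$ (j, i) = conjugate (A $$ (i, j))"
    using assms(1,3,4) by (intro mat_adjoint_index) auto
  then show ?thesis using assms(2) by simp
qed

lemma cmod_diag_le_op_norm:
  assumes "A \<in> carrier_mat n n" "i < n"
  shows "cmod (A $$ (i, i)) \<le> op_norm A"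
  using cmod_quadratic_form_le[OF assms(1), of "unit_vec n i"] assms
  by (simp add: quadratic_form_unit_vec euclid_norm_unit_vec)

text \<open>On vectors of norm 1 the forms of \<open>X\<close> and of its diagonal part both take
  values between \<delta> and \<open>op_norm X\<close>. Two numbers in this interval differ by at
  most its length, and the difference matrix is Hermitian, so its form controls its norm.\<close>

lemma op_norm_minus_diag_le:
  assumes X: "X \<in> carrier_mat n n" "mat_adjoint X = X" and n: "0 < n"
    and coercive: "\<And>v. v \<in> carrier_vec n \<Longrightarrow> \<delta> * (euclid_norm v)\<^sup>2 \<le> Re ((X *\<^sub>v v) \<bullet>c v)"
  shows "op_norm (X - mat_diag n (\<lambda>i. X $$ (i, i))) \<le> op_norm X - \<delta>"
proof -
  define P where "P = mat_diag n (\<lambda>i. X $$ (i, i))"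
  have P: "P \<in> carrier_mat n n" by (simp add: P_def mat_diag_def)
  have upper: "Re ((X *\<^sub>v v) \<bullet>c v) \<le> op_norm X * (euclid_norm v)\<^sup>2" if "v \<in> carrier_vec n" for v
    using complex_Re_le_cmod cmod_quadratic_form_le[OF X(1) that] by (rule order_trans)
  have diag: "\<delta> \<le> Re (X $$ (i, i))" "Re (X $$ (i, i)) \<le> op_norm X" if "i < n" for i
    using coercive[of "unit_vec n i"] upper[of "unit_vec n i"] that X
    by (simp_all add: quadratic_form_unit_vec euclid_norm_unit_vec)
  \<comment> \<open>The form of the diagonal part is a sum of diagonal entries with weights adding
    up to the squared norm, so it inherits the bounds in \<open>diag\<close>.\<close>
  have form_P: "Re ((P *\<^sub>v v) \<bullet>c v) = (\<Sum>i<n. Re (X $$ (i, i)) * (cmod (v $ i))\<^sup>2)"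
    if v: "v \<in> carrier_vec n" for v
  proof -
    have "Re (X $$ (i, i) * v $ i * cnj (v $ i)) = Re (X $$ (i, i)) * (cmod (v $ i))\<^sup>2" for i
      by (simp add: complex_mult_cnj mult.assoc cmod_power2)
    then show ?thesis
      using v by (simp del: index_mult_mat_vec
          add: P_def cscalar_prod_sum[where n = n] mat_diag_mult_vec_index)
  qed
  have nv: "(euclid_norm v)\<^sup>2 = (\<Sum>i<n. (cmod (v $ i))\<^sup>2)" if "v \<in> carrier_vec n" for v
    using that by (simp add: euclid_norm_sq)
  have "op_norm (X - P) \<le> op_norm X - \<delta>"
  proof (rule op_norm_hermitian_le)
    show "X - P \<in> carrier_mat n n" using P by auto
    show "mat_adjoint (X - P) = X - P"
    proof (rule eq_matI)
      fix i j assume "i < dim_row (X - P)" "j < dim_col (X - P)"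
      then have ij: "i < n" "j < n" using P by auto
      show "mat_adjoint (X - P) $$ (i, j) = (X - P) $$ (i, j)"
        using X P ij hermitian_index[OF X ij] hermitian_index[OF X ij(1) ij(1)]
        by (auto simp: P_def mat_diag_def)
    qed (use P in auto)
    \<comment> \<open>Since \<open>0 < n\<close>, there is a diagonal entry, and it lies between the
      two numbers.\<close>
    show "0 \<le> op_norm X - \<delta>" using diag[OF n] by simp
    fix v :: "complex vec" assume v: "v \<in> carrier_vec n"
    have "((X - P) *\<^sub>v v) \<bullet>c v = (X *\<^sub>v v) \<bullet>c v - (P *\<^sub>v v) \<bullet>c v"
      using v X P by (simp add: minus_mult_distrib_mat_vec minus_scalar_prod_distrib[of _ n])
    moreover have "Re ((P *\<^sub>v v) \<bullet>c v) \<le> op_norm X * (euclid_norm v)\<^sup>2"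
      using diag(2) by (auto simp: form_P[OF v] nv[OF v] sum_distrib_left intro!: sum_mono mult_right_mono)
    moreover have "\<delta> * (euclid_norm v)\<^sup>2 \<le> Re ((P *\<^sub>v v) \<bullet>c v)"
      using diag(1) by (auto simp: form_P[OF v] nv[OF v] sum_distrib_left intro!: sum_mono mult_right_mono)
    ultimately show "\<bar>Re (((X - P) *\<^sub>v v) \<bullet>c v)\<bar> \<le> (op_norm X - \<delta>) * (euclid_norm v)\<^sup>2"
      using upper[OF v] coercive[OF v] by (auto simp: left_diff_distrib)
  qed
  then show ?thesis by (simp add: P_def)
qed

section \<open>The C*-inequality and the Cholesky factorisation\<close>

text \<open>The squared norm of \<open>C *\<^sub>v v\<close> is the inner product of
  \<open>v\<close> with its image under \<open>mat_adjoint C * C\<close>. This half of the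
  C*-identity bounds the Cholesky factors by the matrix they factor, and later bounds the
  adjoint.\<close>

lemma op_norm_sq_le:
  assumes "C \<in> carrier_mat n n"
  shows "(op_norm C)\<^sup>2 \<le> op_norm (mat_adjoint C * C)"
proof -
  have C': "mat_adjoint C \<in> carrier_mat n n" by (rule mat_adjoint_carrier[OF assms])
  have "op_norm C \<le> sqrt (op_norm (mat_adjoint C * C))"
  proof (rule op_norm_least)
    fix v assume "v \<in> carrier_vec (dim_col C)" and v1: "euclid_norm v \<le> 1"
    then have v: "v \<in> carrier_vec n" using assms by auto
    have Cv: "C *\<^sub>v v \<in> carrier_vec n" using assms v by auto
    have "(euclid_norm (C *\<^sub>v v))\<^sup>2 = cmod ((C *\<^sub>v v) \<bullet>c (C *\<^sub>v v))"
      by (simp add: cscalar_prod_self norm_power)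
    also have "\<dots> = cmod (v \<bullet>c ((mat_adjoint C * C) *\<^sub>v v))"
      using C' v Cv assms by (simp add: cscalar_prod_mult_mat_vec[OF assms v Cv])
    also have "\<dots> \<le> euclid_norm v * euclid_norm ((mat_adjoint C * C) *\<^sub>v v)"
      using C' v assms by (intro cmod_cscalar_prod_le[of _ n]) auto
    also have "\<dots> \<le> 1 * op_norm (mat_adjoint C * C)"
      using C' v assms v1 by (intro mult_mono op_norm_upper) (auto simp: euclid_norm_nonneg)
    finally show "euclid_norm (C *\<^sub>v v) \<le> sqrt (op_norm (mat_adjoint C * C))"
      by (simp add: real_le_rsqrt)
  qed
  then show ?thesis
    using power_mono[OF _ op_norm_nonneg, of C "sqrt (op_norm (mat_adjoint C * C))" 2]
    by (simp add: op_norm_nonneg)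
qed

text \<open>Induction on the Schur complement of the last diagonal entry.\<close>

lemma cholesky_fun:
  fixes A :: "nat \<Rightarrow> nat \<Rightarrow> complex"
  assumes "0 < \<delta>" and "\<And>i j. i < n \<Longrightarrow> j < n \<Longrightarrow> A j i = cnj (A i j)"
    and "\<And>v. \<delta> * (\<Sum>i<n. (cmod (v i))\<^sup>2) \<le> Re (\<Sum>i<n. \<Sum>j<n. cnj (v i) * A i j * v j)"
  shows "\<exists>C. \<forall>i<n. \<forall>j<n. A i j = (\<Sum>k<n. cnj (C k i) * C k j)"
  using assms(2,3)
proof (induction n arbitrary: A)
  case 0
  then show ?case by simp
next
  case (Suc n)
  note herm = Suc.prems(1) and coercive = Suc.prems(2)
  define r where "r = Re (A n n)"
  have "A n n = cnj (A n n)" by (rule herm) auto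
  then have d: "A n n = of_real r" by (simp add: r_def complex_eq_iff)
  \<comment> \<open>The last basis vector as test vector bounds the pivot away from 0.\<close>
  have "\<delta> \<le> r"
    using coercive[of "\<lambda>i. if i = n then 1 else 0"] by (simp add: r_def)
  then have r: "r > 0" using assms(1) by simp
  define S where "S i j = A i j - A i n * A n j / r" for i j
  have "\<exists>C. \<forall>i<n. \<forall>j<n. S i j = (\<Sum>k<n. cnj (C k i) * C k j)"
  proof (rule Suc.IH)
    fix i j assume "i < n" "j < n"
    then show "S j i = cnj (S i j)"
      using herm[of i j] herm[of n j] herm[of i n] by (simp add: S_def mult.commute)
  next
    fix v :: "nat \<Rightarrow> complex"
    define s where "s = (\<Sum>j<n. A n j * v j)"
    \<comment> \<open>This last coordinate minimises the form of \<open>A\<close> for fixed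
      \<open>v\<close>; completing the square, the minimum is the form of the Schur complement
      \<open>S\<close> at \<open>v\<close>. The extra coordinate only increases the sum of squares,
      so \<open>S\<close> is coercive with the same \<delta>.\<close>
    define v' where "v' = v(n := - s / r)"
    have s': "(\<Sum>i<n. cnj (v i) * A i n) = cnj s"
      using herm[of n] by (auto simp: s_def intro!: sum.cong)
    have "(\<Sum>i<Suc n. \<Sum>j<Suc n. cnj (v' i) * A i j * v' j)
        = (\<Sum>i<n. \<Sum>j<n. cnj (v i) * A i j * v j) + (\<Sum>i<n. cnj (v i) * A i n) * (- s / r)
          + cnj (- s / r) * s + cnj (- s / r) * r * (- s / r)"
    proof -
      have row: "(\<Sum>j<Suc n. c * A i j * v' j) = (\<Sum>j<n. c * A i j * v j) + c * A i n * (- s / r)" for i c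
        by (simp add: v'_def)
      have last: "(\<Sum>j<n. c * A n j * v j) = c * s" for c
        by (simp add: s_def sum_distrib_left mult.assoc)
      have "(\<Sum>i<Suc n. \<Sum>j<Suc n. cnj (v' i) * A i j * v' j)
          = (\<Sum>i<n. (\<Sum>j<n. cnj (v i) * A i j * v j) + cnj (v i) * A i n * (- s / r))
            + (cnj (- s / r) * s + cnj (- s / r) * A n n * (- s / r))"
        unfolding row last sum.lessThan_Suc[of _ n] by (simp add: v'_def)
      then show ?thesis by (simp only: sum.distrib sum_distrib_right[symmetric] d add.assoc)
    qed
    also have "\<dots> = (\<Sum>i<n. \<Sum>j<n. cnj (v i) * A i j * v j) - cnj s * s / r"
      unfolding s' using r by simp
    also have "cnj s * s / r = (\<Sum>i<n. \<Sum>j<n. cnj (v i) * A i n * (A n j * v j) / r)"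
      by (simp only: s'[symmetric]) (simp only: s_def sum_product sum_divide_distrib)
    also have "(\<Sum>i<n. \<Sum>j<n. cnj (v i) * A i j * v j) - \<dots> = (\<Sum>i<n. \<Sum>j<n. cnj (v i) * S i j * v j)"
      unfolding sum_subtractf[symmetric]
      by (intro sum.cong refl) (simp add: S_def algebra_simps)
    finally have eq: "(\<Sum>i<Suc n. \<Sum>j<Suc n. cnj (v' i) * A i j * v' j)
        = (\<Sum>i<n. \<Sum>j<n. cnj (v i) * S i j * v j)" .
    have "\<delta> * (\<Sum>i<n. (cmod (v i))\<^sup>2) \<le> \<delta> * (\<Sum>i<Suc n. (cmod (v' i))\<^sup>2)"
      using assms(1) by (intro mult_left_mono) (auto simp: v'_def)
    also have "\<dots> \<le> Re (\<Sum>i<n. \<Sum>j<n. cnj (v i) * S i j * v j)"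
      using coercive[of v'] unfolding eq .
    finally show "\<delta> * (\<Sum>i<n. (cmod (v i))\<^sup>2) \<le> Re (\<Sum>i<n. \<Sum>j<n. cnj (v i) * S i j * v j)" .
  qed
  then obtain C where C: "\<And>i j. i < n \<Longrightarrow> j < n \<Longrightarrow> S i j = (\<Sum>k<n. cnj (C k i) * C k j)"
    by blast
  \<comment> \<open>The factor of \<open>S\<close>, bordered by a new last row and by zeros above
    the corner. The new row contributes exactly the rank-one term that was subtracted in
    \<open>S\<close>.\<close>
  define C' where "C' k j = (if k = n then A n j / sqrt r else if j = n then 0 else C k j)" for k j
  have "A i j = (\<Sum>k<Suc n. cnj (C' k i) * C' k j)" if "i < Suc n" "j < Suc n" for i j
  proof -
    have "cnj (C' n i) * C' n j = A i n * A n j / r"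
      using that r herm[of n i] by (simp add: C'_def flip: of_real_mult)
    moreover have "(\<Sum>k<n. cnj (C' k i) * C' k j) = S i j"
    proof (cases "i = n \<or> j = n")
      \<comment> \<open>Both sides vanish: \<open>C'\<close> has zeros above the corner, and
        elimination clears the last row and column of \<open>S\<close>.\<close>
      case True
      then have "(\<Sum>k<n. cnj (C' k i) * C' k j) = 0"
        by (intro sum.neutral) (auto simp: C'_def)
      then show ?thesis using True r by (auto simp: S_def d)
    next
      case False
      then show ?thesis using that C[of i j] by (auto simp: C'_def)
    qed
    ultimately show ?thesis by (simp add: S_def)
  qed
  then show ?case by blast
qed

text \<open>Index functions let the induction lower \<open>n\<close> without resizing matrices; here
  the result is carried back to matrices, with \<open>vec n v\<close> as test vectors.\<close>

lemma cholesky: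
  assumes X: "X \<in> carrier_mat n n" "mat_adjoint X = X" and "0 < \<delta>"
    and coercive: "\<And>v. v \<in> carrier_vec n \<Longrightarrow> \<delta> * (euclid_norm v)\<^sup>2 \<le> Re ((X *\<^sub>v v) \<bullet>c v)"
  shows "\<exists>C\<in>carrier_mat n n. mat_adjoint C * C = X"
proof -
  have "\<exists>C. \<forall>i<n. \<forall>j<n. X $$ (i, j) = (\<Sum>k<n. cnj (C k i) * C k j)"
  proof (rule cholesky_fun[OF \<open>0 < \<delta>\<close>])
    fix i j assume "i < n" "j < n"
    from hermitian_index[OF X this] show "X $$ (j, i) = cnj (X $$ (i, j))"
      by (simp only: conjugate_complex_def)
  next
    fix v :: "nat \<Rightarrow> complex"
    have "(X *\<^sub>v vec n v) \<bullet>c vec n v = (\<Sum>i<n. \<Sum>j<n. cnj (v i) * X $$ (i, j) * v j)"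
      by (simp del: index_mult_mat_vec
          add: cscalar_prod_sum[where n = n] mult_mat_vec_sum[OF X(1)] sum_distrib_left mult_ac)
    then show "\<delta> * (\<Sum>i<n. (cmod (v i))\<^sup>2) \<le> Re (\<Sum>i<n. \<Sum>j<n. cnj (v i) * X $$ (i, j) * v j)"
      using coercive[of "vec n v"] by (simp add: euclid_norm_sq)
  qed
  then obtain C where C: "\<And>i j. i < n \<Longrightarrow> j < n \<Longrightarrow> X $$ (i, j) = (\<Sum>k<n. cnj (C k i) * C k j)"
    by blast
  define M where "M = mat n n (\<lambda>(i, j). C i j)"
  have M: "M \<in> carrier_mat n n" by (simp add: M_def)
  have "mat_adjoint M * M = X"
  proof (rule eq_matI)
    fix i j assume "i < dim_row X" "j < dim_col X"
    then have "i < n" "j < n" using X by auto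
    then show "(mat_adjoint M * M) $$ (i, j) = X $$ (i, j)"
      using C by (simp only: mult_adjoint_index[OF M]) (simp add: M_def)
  qed (use X M in auto)
  then show ?thesis using M by blast
qed

section \<open>The algebra of bounded sequences and its quotient norm\<close>

lemma MM_norm_nonneg: "a \<in> carrier MM \<Longrightarrow> 0 \<le> MM_norm a"
  using op_norm_le_MM_norm[of a 2] op_norm_nonneg[of "a 2"] by simp

lemma MM_minus_index:
  assumes "a \<in> carrier MM" "b \<in> carrier MM" "n \<ge> 2"
  shows "(a \<ominus>\<^bsub>MM\<^esub> b) n = a n - b n"
  using assms MM_carrierD(1)[OF assms(1,3)] MM_carrierD(1)[OF assms(2,3)]
  by (simp add: a_minus_def MM_ops MM_a_inv add_uminus_minus_mat)

lemma cond_exp_closed: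
  assumes "a \<in> carrier MM"
  shows "cond_exp a \<in> carrier MM"
proof (rule MM_carrierI[where c = "MM_norm a"])
  fix n :: nat assume n: "n \<ge> 2"
  show "cond_exp a n \<in> carrier_mat n n" using n by (simp add: cond_exp_def mat_diag_def)
  have "op_norm (cond_exp a n) \<le> op_norm (a n)"
    using n op_norm_mat_diag_le[of n _ "op_norm (a n)"] cmod_diag_le_op_norm[OF MM_carrierD(1)[OF assms n]]
    by (simp add: cond_exp_def op_norm_nonneg)
  then show "op_norm (cond_exp a n) \<le> MM_norm a"
    using op_norm_le_MM_norm[OF assms n] by simp
qed (simp add: cond_exp_def)

text \<open>A compact element can cancel the finitely many coordinates below \<open>N\<close>, which
  leaves a representative of the coset with norm at most \<open>c\<close>.\<close>

lemma quot_norm_le: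
  assumes a: "a \<in> carrier MM" and c: "0 \<le> c" "\<And>n. n \<ge> N \<Longrightarrow> n \<ge> 2 \<Longrightarrow> op_norm (a n) \<le> c"
  shows "quot_norm (quot_map a) \<le> c"
proof -
  define k where "k = (\<lambda>n\<in>{2..}. if n < N then - a n else 0\<^sub>m n n)"
  have kM: "k \<in> carrier MM"
    using MM_carrierD(1)[OF a] op_norm_le_MM_norm[OF a] MM_norm_nonneg[OF a]
    by (intro MM_carrierI[where c = "MM_norm a"])
      (auto simp: k_def op_norm_uminus[OF MM_carrierD(1)[OF a]] op_norm_zero)
  have "(\<lambda>n. op_norm (k n)) \<longlonglongrightarrow> 0"
    by (rule tendsto_eventually)
      (auto simp: eventually_sequentially k_def op_norm_zero intro!: exI[of _ "max 2 N"])
  then have "k \<oplus>\<^bsub>MM\<^esub> a \<in> quot_map a"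
    using kM by (auto simp: quot_map_def a_r_coset_def' KK_iff)
  moreover have "bdd_below (MM_norm ` quot_map a)"
    using a by (intro bdd_belowI[of _ 0])
      (auto simp: quot_map_def a_r_coset_def' KK_iff intro!: MM_norm_nonneg MM_add_closed)
  ultimately have "quot_norm (quot_map a) \<le> MM_norm (k \<oplus>\<^bsub>MM\<^esub> a)"
    unfolding quot_norm_def by (intro cINF_lower)
  also have "\<dots> \<le> c"
  proof (rule MM_norm_le)
    fix n :: nat assume n: "n \<ge> 2"
    show "op_norm ((k \<oplus>\<^bsub>MM\<^esub> a) n) \<le> c"
      using n c MM_carrierD(1)[OF a n]
      by (auto simp: MM_ops k_def uminus_l_inv_mat op_norm_zero)
  qed
  finally show ?thesis .
qed

lemma eventually_op_norm_le_quot_norm: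
  assumes a: "a \<in> carrier MM" and e: "0 < \<epsilon>"
  obtains N where "\<And>n. n \<ge> N \<Longrightarrow> n \<ge> 2 \<Longrightarrow> op_norm (a n) \<le> quot_norm (quot_map a) + \<epsilon>"
proof -
  \<comment> \<open>The coset must be nonempty before a near-minimal representative can be
    chosen.\<close>
  have "\<zero>\<^bsub>MM\<^esub> \<in> KK"
    using ideal.axioms(1)[OF ideal_KK] by (rule additive_subgroup.zero_closed)
  then have "quot_map a \<noteq> {}" by (auto simp: quot_map_def a_r_coset_def')
  then obtain b where "b \<in> quot_map a" and b: "MM_norm b < quot_norm (quot_map a) + \<epsilon> / 2"
    using cInf_lessD[of "MM_norm ` quot_map a" "quot_norm (quot_map a) + \<epsilon> / 2"] e
    by (auto simp: quot_norm_def)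
  then obtain k where "k \<in> KK" and bk: "b = k \<oplus>\<^bsub>MM\<^esub> a"
    by (auto simp: quot_map_def a_r_coset_def')
  then have k: "k \<in> carrier MM" and "(\<lambda>n. op_norm (k n)) \<longlonglongrightarrow> 0" by (auto simp: KK_iff)
  then have "\<forall>\<^sub>F n in sequentially. op_norm (k n) < \<epsilon> / 2"
    using e by (intro order_tendstoD(2)[of _ 0]) auto
  then obtain N where N: "\<And>n. n \<ge> N \<Longrightarrow> op_norm (k n) < \<epsilon> / 2"
    by (auto simp: eventually_sequentially)
  show thesis
  proof (rule that)
    fix n assume "n \<ge> N" and n: "n \<ge> 2"
    note kn = MM_carrierD(1)[OF k n] and an = MM_carrierD(1)[OF a n]
    have "a n = - k n + (k n + a n)"
      using kn an by (intro eq_matI) auto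
    then have "op_norm (a n) \<le> op_norm (- k n) + op_norm (k n + a n)"
      using op_norm_add[of "- k n" n "k n + a n"] kn an by simp
    also have "op_norm (- k n) = op_norm (k n)" using kn by (rule op_norm_uminus)
    also have "op_norm (k n + a n) \<le> MM_norm b"
      using op_norm_le_MM_norm[OF MM_add_closed[OF k a] n] n by (simp add: bk MM_ops)
    finally show "op_norm (a n) \<le> quot_norm (quot_map a) + \<epsilon>"
      using N[OF \<open>n \<ge> N\<close>] b by simp
  qed
qed

section \<open>Elements bounded below by a positive scalar\<close>

text \<open>This is the order relation \<open>x \<ge> \<delta> 1\<close>, with one \<delta> for all
  coordinates. It is phrased by quadratic forms because membership in \<open>MM_pos\<close> asks for
  a factor that has yet to be built.\<close>

definition coercive :: "real \<Rightarrow> (nat \<Rightarrow> complex mat) \<Rightarrow> bool" where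
  "coercive \<delta> x \<longleftrightarrow> x \<in> carrier MM \<and> (\<forall>n\<ge>2. mat_adjoint (x n) = x n \<and>
     (\<forall>v\<in>carrier_vec n. \<delta> * (euclid_norm v)\<^sup>2 \<le> Re ((x n *\<^sub>v v) \<bullet>c v)))"

text \<open>The Cholesky factors of the coordinates form a bounded sequence: by the C*-inequality
  their squared norms are at most \<open>MM_norm x\<close>.\<close>

lemma coercive_imp_MM_pos:
  assumes "coercive \<delta> x" "0 < \<delta>"
  shows "x \<in> MM_pos"
proof -
  have x: "x \<in> carrier MM" using assms(1) by (simp add: coercive_def)
  have "\<exists>C\<in>carrier_mat n n. mat_adjoint C * C = x n" if "n \<ge> 2" for n
    using assms that MM_carrierD(1)[OF x] unfolding coercive_def
    by (intro cholesky[where \<delta> = \<delta>]) auto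
  then obtain C where C: "\<And>n. n \<ge> 2 \<Longrightarrow> C n \<in> carrier_mat n n"
    "\<And>n. n \<ge> 2 \<Longrightarrow> mat_adjoint (C n) * C n = x n"
    by metis
  define y where "y = (\<lambda>n\<in>{2..}. C n)"
  have y: "y \<in> carrier MM"
  proof (rule MM_carrierI[where c = "sqrt (MM_norm x)"])
    fix n :: nat assume n: "n \<ge> 2"
    have "(op_norm (C n))\<^sup>2 \<le> MM_norm x"
      using op_norm_sq_le[OF C(1)[OF n]] C(2)[OF n] op_norm_le_MM_norm[OF x n] by simp
    then show "op_norm (y n) \<le> sqrt (MM_norm x)" using n by (simp add: y_def real_le_rsqrt)
  qed (use C in \<open>auto simp: y_def\<close>)
  have "x = MM_star y \<otimes>\<^bsub>MM\<^esub> y"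
    using MM_carrierD(2)[OF x] C
    by (intro extensionalityI[of x "{2..}"]) (auto simp: MM_def MM_star_def y_def)
  then show ?thesis using y by (auto simp: MM_pos_def)
qed

lemma coercive_imp_weakly_paveable:
  assumes co: "coercive \<delta> x" and d: "0 < \<delta>"
  shows "weakly_paveable x"
proof -
  interpret ring MM by (rule ring_MM)
  have x: "x \<in> carrier MM" using co by (simp add: coercive_def)
  have Px: "cond_exp x \<in> carrier MM" by (rule cond_exp_closed[OF x])
  define z where "z = x \<ominus>\<^bsub>MM\<^esub> cond_exp x"
  have z: "z \<in> carrier MM" using x Px by (simp add: z_def)
  have zn: "op_norm (z n) \<le> op_norm (x n) - \<delta>" if n: "n \<ge> 2" for n
    using op_norm_minus_diag_le[of "x n" n \<delta>] co n MM_carrierD(1)[OF x n]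
    unfolding z_def MM_minus_index[OF x Px n] by (simp add: cond_exp_def coercive_def)
  \<comment> \<open>This lower bound keeps \<open>x\<close> out of \<open>KK\<close> and later makes
    the bound on the quotient norm of \<open>z\<close> nonnegative.\<close>
  have xn: "\<delta> \<le> op_norm (x n)" if "n \<ge> 2" for n
    using zn[OF that] op_norm_nonneg[of "z n"] by simp
  have "x \<notin> KK"
  proof
    assume "x \<in> KK"
    then have "(\<lambda>n. op_norm (x n)) \<longlonglongrightarrow> 0" by (simp add: KK_iff)
    then have "\<delta> \<le> 0"
      by (rule tendsto_lowerbound) (use xn in \<open>auto simp: eventually_sequentially intro!: exI[of _ 2]\<close>)
    then show False using d by simp
  qed
  moreover have "\<one>\<^bsub>MM\<^esub> \<in> projections \<inter> DD"
  proof -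
    have "mat_adjoint (1\<^sub>m n) = (1\<^sub>m n :: complex mat)" for n
      by (intro eq_matI) auto
    then have "MM_star \<one>\<^bsub>MM\<^esub> = \<one>\<^bsub>MM\<^esub>"
      by (auto simp: MM_star_def MM_def)
    then show ?thesis by (auto simp: projections_def DD_def MM_ops diagonal_mat_def)
  qed
  moreover have "quot_norm (quot_map z) < quot_norm (quot_map x)"
  proof -
    let ?q = "quot_norm (quot_map x)"
    \<comment> \<open>Half of the gap pays for comparing the tail of \<open>x\<close> with its
      quotient norm; the other half keeps the inequality strict.\<close>
    obtain N where N: "\<And>n. n \<ge> N \<Longrightarrow> n \<ge> 2 \<Longrightarrow> op_norm (x n) \<le> ?q + \<delta> / 2"
      using eventually_op_norm_le_quot_norm[OF x, of "\<delta> / 2"] d by auto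
    have "quot_norm (quot_map z) \<le> ?q - \<delta> / 2"
    proof (rule quot_norm_le[OF z])
      show "0 \<le> ?q - \<delta> / 2" using N[of "max N 2"] xn[of "max N 2"] by simp
      show "op_norm (z n) \<le> ?q - \<delta> / 2" if "n \<ge> N" "n \<ge> 2" for n
        using N[OF that] zn[OF that(2)] by simp
    qed
    then show ?thesis using d by simp
  qed
  ultimately have "(\<forall>j\<in>{1..1::nat}. \<one>\<^bsub>MM\<^esub> \<in> projections \<inter> DD)
      \<and> finsum MM (\<lambda>_. \<one>\<^bsub>MM\<^esub>) {1..1::nat} = \<one>\<^bsub>MM\<^esub>
      \<and> (\<forall>j\<in>{1..1::nat}. quot_norm (quot_map (\<one>\<^bsub>MM\<^esub> \<otimes>\<^bsub>MM\<^esub> z \<otimes>\<^bsub>MM\<^esub> \<one>\<^bsub>MM\<^esub>)) < quot_norm (quot_map x))"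
    using z by simp
  then show ?thesis
    unfolding weakly_paveable_def z_def
    using coercive_imp_MM_pos[OF co d] \<open>x \<notin> KK\<close>
    by (intro conjI exI[of _ "1 :: nat"] exI[of _ "\<lambda>_. \<one>\<^bsub>MM\<^esub>"]) blast+
qed

section \<open>Positive elements and their scalar perturbations\<close>

lemma mat_adjoint_adjoint: "mat_adjoint (mat_adjoint A) = (A :: complex mat)"
  by (rule eq_matI) auto

text \<open>Apply the C*-inequality to the adjoint, use submultiplicativity, and cancel one factor
  unless it is 0.\<close>

lemma op_norm_adjoint_le:
  assumes A: "A \<in> carrier_mat n n"
  shows "op_norm (mat_adjoint A) \<le> op_norm A"
proof -
  note A' = mat_adjoint_carrier[OF A]
  have "(op_norm (mat_adjoint A))\<^sup>2 \<le> op_norm (A * mat_adjoint A)"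
    using op_norm_sq_le[OF A'] by (simp add: mat_adjoint_adjoint)
  also have "\<dots> \<le> op_norm A * op_norm (mat_adjoint A)" by (rule op_norm_mult[OF A A'])
  finally show ?thesis
    using op_norm_nonneg[of "mat_adjoint A"] op_norm_nonneg[of A]
    by (cases "op_norm (mat_adjoint A) = 0") (auto simp: power2_eq_square)
qed

lemma MM_star_closed:
  assumes "a \<in> carrier MM"
  shows "MM_star a \<in> carrier MM"
proof (rule MM_carrierI[where c = "MM_norm a"])
  fix n :: nat assume n: "n \<ge> 2"
  note an = MM_carrierD(1)[OF assms n]
  show "MM_star a n \<in> carrier_mat n n"
    using n mat_adjoint_carrier[OF an] by (simp add: MM_star_def)
  show "op_norm (MM_star a n) \<le> MM_norm a"
    using n order_trans[OF op_norm_adjoint_le[OF an] op_norm_le_MM_norm[OF assms n]]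
    by (simp add: MM_star_def)
qed (simp add: MM_star_def)

lemma MM_pos_subset: "MM_pos \<subseteq> carrier MM"
  by (auto simp: MM_pos_def intro!: MM_mult_closed MM_star_closed)

text \<open>The form of \<open>a\<close> at \<open>v\<close> is the squared norm of the image of
  \<open>v\<close> under the factor, hence nonnegative; \<open>e\<close>, which is \<delta> times
  the unit, adds the coercive term.\<close>

lemma coercive_add_scalar:
  assumes "a \<in> MM_pos" "0 \<le> \<delta>"
  defines "e \<equiv> (\<lambda>n\<in>{2..}. mat_diag n (\<lambda>_. complex_of_real \<delta>))"
  shows "e \<in> carrier MM" "coercive \<delta> (a \<oplus>\<^bsub>MM\<^esub> e)" "MM_norm e \<le> \<delta>"
proof -
  obtain y where y: "y \<in> carrier MM" and ay: "a = MM_star y \<otimes>\<^bsub>MM\<^esub> y"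
    using assms(1) by (auto simp: MM_pos_def)
  note yn = MM_carrierD(1)[OF y]
  have an: "a n = mat_adjoint (y n) * y n" if "n \<ge> 2" for n
    using that by (simp add: ay MM_ops MM_star_def)
  have en: "e n \<in> carrier_mat n n" if "n \<ge> 2" for n
    using that by (simp add: e_def mat_diag_def)
  have en_le: "op_norm (e n) \<le> \<delta>" if "n \<ge> 2" for n
    using that assms(2) by (simp add: e_def op_norm_mat_diag_le)
  show e: "e \<in> carrier MM"
    using en en_le by (intro MM_carrierI[where c = \<delta>]) (auto simp: e_def)
  show "MM_norm e \<le> \<delta>" using en_le by (rule MM_norm_le)
  have a: "a \<in> carrier MM" using assms(1) MM_pos_subset by blast
  show "coercive \<delta> (a \<oplus>\<^bsub>MM\<^esub> e)"
    unfolding coercive_def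
  proof (intro conjI allI impI ballI)
    show "a \<oplus>\<^bsub>MM\<^esub> e \<in> carrier MM" using a e by (rule MM_add_closed)
    fix n :: nat assume n: "n \<ge> 2"
    note an_c = MM_carrierD(1)[OF a n]
    show "mat_adjoint ((a \<oplus>\<^bsub>MM\<^esub> e) n) = (a \<oplus>\<^bsub>MM\<^esub> e) n"
    proof (rule eq_matI)
      fix i j assume "i < dim_row ((a \<oplus>\<^bsub>MM\<^esub> e) n)" "j < dim_col ((a \<oplus>\<^bsub>MM\<^esub> e) n)"
      then have ij: "i < n" "j < n" using n an_c en[OF n] by (auto simp: MM_ops)
      have "a n $$ (j, i) = cnj (a n $$ (i, j))"
        using ij yn[OF n] by (simp add: an[OF n] mult_adjoint_index mult.commute del: index_mult_mat)
      then show "mat_adjoint ((a \<oplus>\<^bsub>MM\<^esub> e) n) $$ (i, j) = (a \<oplus>\<^bsub>MM\<^esub> e) n $$ (i, j)"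
        using ij n an_c by (simp add: MM_ops e_def mat_diag_def)
    qed (use n an_c en[OF n] in \<open>auto simp: MM_ops\<close>)
    fix v :: "complex vec" assume v: "v \<in> carrier_vec n"
    have yv: "y n *\<^sub>v v \<in> carrier_vec n" using yn[OF n] v by auto
    have "(a n *\<^sub>v v) \<bullet>c v = (mat_adjoint (y n) *\<^sub>v (y n *\<^sub>v v)) \<bullet>c v"
      using an[OF n] yn[OF n] v mat_adjoint_carrier[OF yn[OF n]] by simp
    \<comment> \<open>The adjoint rule is stated with the adjoint in the second argument. Swapping
      the arguments costs a conjugation, harmless because the value is real.\<close>
    also have "\<dots> = cnj (v \<bullet>c (mat_adjoint (y n) *\<^sub>v (y n *\<^sub>v v)))"
      using v yv yn[OF n] mat_adjoint_carrier[OF yn[OF n]]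
      by (intro cnj_cscalar_prod[symmetric, of _ n]) auto
    also have "\<dots> = (euclid_norm (y n *\<^sub>v v))\<^sup>2"
      by (simp only: cscalar_prod_mult_mat_vec[OF yn[OF n] v yv, symmetric] cscalar_prod_self
          complex_cnj_complex_of_real)
    finally have "0 \<le> Re ((a n *\<^sub>v v) \<bullet>c v)" by (simp del: of_real_power)
    moreover have "e n *\<^sub>v v = complex_of_real \<delta> \<cdot>\<^sub>v v"
    proof (rule eq_vecI)
      fix i assume "i < dim_vec (complex_of_real \<delta> \<cdot>\<^sub>v v)"
      then have i: "i < n" using v by simp
      then show "(e n *\<^sub>v v) $ i = (complex_of_real \<delta> \<cdot>\<^sub>v v) $ i"
        using v n mat_diag_mult_vec_index[OF v i] by (simp add: e_def del: index_mult_mat_vec)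
    qed (use en[OF n] v in auto)
    moreover have "((a \<oplus>\<^bsub>MM\<^esub> e) n *\<^sub>v v) \<bullet>c v = (a n *\<^sub>v v) \<bullet>c v + (e n *\<^sub>v v) \<bullet>c v"
      using n an_c en[OF n] v
      by (simp add: MM_ops add_mult_distrib_mat_vec add_scalar_prod_distrib[of _ n])
    ultimately show "\<delta> * (euclid_norm v)\<^sup>2 \<le> Re (((a \<oplus>\<^bsub>MM\<^esub> e) n *\<^sub>v v) \<bullet>c v)"
      using v by (simp add: cscalar_prod_self)
  qed
qed

theorem theorem3p2:
  "\<forall>a\<in>MM_pos. \<forall>\<epsilon>>0. \<exists>x. weakly_paveable x \<and> MM_norm (x \<ominus>\<^bsub>MM\<^esub> a) < \<epsilon>"
proof (intro ballI allI impI)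
  interpret ring MM by (rule ring_MM)
  fix a and \<epsilon> :: real assume a: "a \<in> MM_pos" and eps: "\<epsilon> > 0"
  \<comment> \<open>Half of \<epsilon>, since the norm of \<open>e\<close> is only bounded weakly
    and the conclusion is strict.\<close>
  define e where "e = (\<lambda>n\<in>{2..}. mat_diag n (\<lambda>_. complex_of_real (\<epsilon> / 2)))"
  have e: "e \<in> carrier MM" "coercive (\<epsilon> / 2) (a \<oplus>\<^bsub>MM\<^esub> e)" "MM_norm e \<le> \<epsilon> / 2"
    using coercive_add_scalar[OF a, of "\<epsilon> / 2"] eps by (simp_all add: e_def)
  have aM: "a \<in> carrier MM" using a MM_pos_subset by blast
  have "a \<oplus>\<^bsub>MM\<^esub> e \<ominus>\<^bsub>MM\<^esub> a = e"
    using aM e(1) by (simp add: a_minus_def a_comm[of a] a_assoc r_neg)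
  then show "\<exists>x. weakly_paveable x \<and> MM_norm (x \<ominus>\<^bsub>MM\<^esub> a) < \<epsilon>"
    using coercive_imp_weakly_paveable[OF e(2)] e(3) eps by (intro exI[of _ "a \<oplus>\<^bsub>MM\<^esub> e"]) simp
qed

end
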